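(* Let $(A,\mu,\Delta,R)$ be a cobraided bialgebra over $\mathbf{k}$ with multiplication $\mu$ and comultiplication $\Delta$, and let $\alpha\colon A\to A$ be a bialgebra morphism. Then $$A_\alpha=(A,\mu_\alpha,\Delta_\alpha,\alpha,R)$$ is a cobraided Hom-bialgebra, where $\mu_\alpha=\alpha\circ\mu$ and $\Delta_\alpha=\Delta\circ\alpha$.
   Context: $\mathbf{k}$ is a fixed associative and commutative ring of characteristic $0$; modules, tensor products and linear maps are over $\mathbf{k}$. Write $\Delta(x)=\sum x_1\otimes x_2$ (Sweedler) and $xy=\mu(x,y)$. A Hom-bialgebra $(A,\mu,\Delta,\alpha)$ consists of a $\mathbf{k}$-module $A$, a bilinear map $\mu\colon A^{\otimes 2}\to A$, a linear map $\Delta\colon A\to A^{\otimes 2}$ and a linear map $\alpha\colon A\to A$ such that $\alpha\circ\mu=\mu\circ\alpha^{\otimes 2}$, $\mu\circ(\alpha\otimes\mu)=\mu\circ(\mu\otimes\alpha)$, $\alpha^{\otimes 2}\circ\Delta=\Delta\circ\alpha$, $(\alpha\otimes\Delta)\circ\Delta=(\Delta\otimes\alpha)\circ\Delta$, and $\Delta(ab)=\sum a_1b_1\otimes a_2b_2$ for all $a,b\in A$. A bialgebra is a Hom-bialgebra with $\alpha=\mathrm{Id}$ (no unit or counit is required); a bialgebra morphism is a linear map commuting with the multiplications and the comultiplications. A cobraided Hom-bialgebra $(A,\mu,\Delta,\alpha,R)$ is a Hom-bialgebra $(A,\mu,\Delta,\alpha)$ with a bilinear form $R\in\mathrm{Hom}(A^{\otimes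 2},\mathbf{k})$ such that for all $x,y,z\in A$: (1) $R(xy\otimes\alpha(z))=\sum R(\alpha(x)\otimes z_1)R(\alpha(y)\otimes z_2)$; (2) $R(\alpha(x)\otimes yz)=\sum R(x_1\otimes\alpha(z))R(x_2\otimes\alpha(y))$; (3) $\sum y_1x_1R(x_2\otimes y_2)=\sum R(x_1\otimes y_1)x_2y_2$. A cobraided bialgebra $(A,\mu,\Delta,R)$ is a bialgebra with a bilinear form $R$ satisfying (1)–(3) with $\alpha=\mathrm{Id}$ (invertibility of $R$ is not required). *)

theory Defs
  imports "HOL-Algebra.Module" "HOL-Algebra.AbelCoset"
begin

section \<open>Rings of characteristic zero and linear maps\<close>

locale char_zero_cring = cring R for R (structure) +
  assumes char_zero: "\<And>n::nat. n \<noteq> 0 \<Longrightarrow> [n] \<cdot> \<one> \<noteq> \<zero>"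

definition linear_maps ::
  "('k, 'r) ring_scheme \<Rightarrow> ('k, 'a, 'm) module_scheme \<Rightarrow> ('k, 'b, 'n) module_scheme \<Rightarrow> ('a \<Rightarrow> 'b) set"
  where "linear_maps K M N =
    {f \<in> carrier M \<rightarrow> carrier N.
      (\<forall>x\<in>carrier M. \<forall>y\<in>carrier M. f (x \<oplus>\<^bsub>M\<^esub> y) = f x \<oplus>\<^bsub>N\<^esub> f y) \<and>
      (\<forall>r\<in>carrier K. \<forall>x\<in>carrier M. f (r \<odot>\<^bsub>M\<^esub> x) = r \<odot>\<^bsub>N\<^esub> f x)}"

definition bilinear_maps ::
  "('k, 'r) ring_scheme \<Rightarrow> ('k, 'a, 'm) module_scheme \<Rightarrow> ('k, 'b, 'n) module_scheme \<Rightarrow>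
    ('k, 'c, 'p) module_scheme \<Rightarrow> ('a \<Rightarrow> 'b \<Rightarrow> 'c) set"
  where "bilinear_maps K M N P =
    {\<beta>. (\<forall>x\<in>carrier M. \<beta> x \<in> linear_maps K N P) \<and>
        (\<forall>y\<in>carrier N. (\<lambda>x. \<beta> x y) \<in> linear_maps K M P)}"

definition ring_as_module :: "('k, 'r) ring_scheme \<Rightarrow> ('k, 'k) module"
  where "ring_as_module K =
    \<lparr>carrier = carrier K, mult = mult K, one = one K, zero = zero K, add = add K, smult = mult K\<rparr>"

section \<open>Tensor products\<close>

text \<open>HOL-Algebra's module records extend ring records; the fields \<open>mult\<close> and \<open>one\<close>
  play no role in the \<open>module\<close> locale and are left unspecified below.\<close>

definition free_module :: "('k, 'r) ring_scheme \<Rightarrow> 's set \<Rightarrow> ('k, 's \<Rightarrow> 'k) module"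
  where "free_module K S =
    \<lparr>carrier = {c. (\<forall>s\<in>S. c s \<in> carrier K) \<and> (\<forall>s. s \<notin> S \<longrightarrow> c s = \<zero>\<^bsub>K\<^esub>) \<and>
                   finite {s. c s \<noteq> \<zero>\<^bsub>K\<^esub>}},
     mult = undefined, one = undefined,
     zero = (\<lambda>s. \<zero>\<^bsub>K\<^esub>),
     add = (\<lambda>c d s. c s \<oplus>\<^bsub>K\<^esub> d s),
     smult = (\<lambda>r c s. r \<otimes>\<^bsub>K\<^esub> c s)\<rparr>"

definition free_gen :: "('k, 'r) ring_scheme \<Rightarrow> 's \<Rightarrow> 's \<Rightarrow> 'k"
  where "free_gen K s = (\<lambda>t. if t = s then \<one>\<^bsub>K\<^esub> else \<zero>\<^bsub>K\<^esub>)"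

definition submodule_generated ::
  "('k, 'r) ring_scheme \<Rightarrow> ('k, 'a, 'm) module_scheme \<Rightarrow> 'a set \<Rightarrow> 'a set"
  where "submodule_generated K M S = \<Inter>{H. submodule H K M \<and> S \<subseteq> H}"

definition quotient_module ::
  "('k, 'a, 'm) module_scheme \<Rightarrow> 'a set \<Rightarrow> ('k, 'a set) module"
  where "quotient_module M H =
    \<lparr>carrier = a_rcosets\<^bsub>M\<^esub> H,
     mult = undefined, one = undefined,
     zero = H,
     add = set_add M,
     smult = (\<lambda>r X. \<Union>x\<in>X. H +>\<^bsub>M\<^esub> (r \<odot>\<^bsub>M\<^esub> x))\<rparr>"

definition tensor_relators ::
  "('k, 'r) ring_scheme \<Rightarrow> ('k, 'a, 'm) module_scheme \<Rightarrow> ('k, 'b, 'n) module_scheme \<Rightarrow>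
    ('a \<times> 'b \<Rightarrow> 'k) set"
  where "tensor_relators K M N =
    (let F = free_module K (carrier M \<times> carrier N); e = free_gen K in
      {e (x \<oplus>\<^bsub>M\<^esub> x', y) \<ominus>\<^bsub>F\<^esub> (e (x, y) \<oplus>\<^bsub>F\<^esub> e (x', y)) | x x' y.
         x \<in> carrier M \<and> x' \<in> carrier M \<and> y \<in> carrier N} \<union>
      {e (x, y \<oplus>\<^bsub>N\<^esub> y') \<ominus>\<^bsub>F\<^esub> (e (x, y) \<oplus>\<^bsub>F\<^esub> e (x, y')) | x y y'.
         x \<in> carrier M \<and> y \<in> carrier N \<and> y' \<in> carrier N} \<union>
      {e (r \<odot>\<^bsub>M\<^esub> x, y) \<ominus>\<^bsub>F\<^esub> r \<odot>\<^bsub>F\<^esub> e (x, y) | r x y.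
         r \<in> carrier K \<and> x \<in> carrier M \<and> y \<in> carrier N} \<union>
      {e (x, r \<odot>\<^bsub>N\<^esub> y) \<ominus>\<^bsub>F\<^esub> r \<odot>\<^bsub>F\<^esub> e (x, y) | r x y.
         r \<in> carrier K \<and> x \<in> carrier M \<and> y \<in> carrier N})"

definition tensor_kernel ::
  "('k, 'r) ring_scheme \<Rightarrow> ('k, 'a, 'm) module_scheme \<Rightarrow> ('k, 'b, 'n) module_scheme \<Rightarrow>
    ('a \<times> 'b \<Rightarrow> 'k) set"
  where "tensor_kernel K M N =
    submodule_generated K (free_module K (carrier M \<times> carrier N)) (tensor_relators K M N)"

definition tensor_product ::
  "('k, 'r) ring_scheme \<Rightarrow> ('k, 'a, 'm) module_scheme \<Rightarrow> ('k, 'b, 'n) module_scheme \<Rightarrow>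
    ('k, ('a \<times> 'b \<Rightarrow> 'k) set) module"
  where "tensor_product K M N =
    quotient_module (free_module K (carrier M \<times> carrier N)) (tensor_kernel K M N)"

definition pure_tensor ::
  "('k, 'r) ring_scheme \<Rightarrow> ('k, 'a, 'm) module_scheme \<Rightarrow> ('k, 'b, 'n) module_scheme \<Rightarrow>
    'a \<Rightarrow> 'b \<Rightarrow> ('a \<times> 'b \<Rightarrow> 'k) set"
  where "pure_tensor K M N x y =
    tensor_kernel K M N +>\<^bsub>free_module K (carrier M \<times> carrier N)\<^esub> free_gen K (x, y)"

text \<open>The linear map on the tensor product induced by a bilinear map \<open>\<beta>\<close>; existence and uniqueness
  are lemma \<open>tensor_universal\<close> below. Extensionality only pins down the junk values outside the carrier.\<close>

definition tensor_lift ::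
  "('k, 'r) ring_scheme \<Rightarrow> ('k, 'a, 'm) module_scheme \<Rightarrow> ('k, 'b, 'n) module_scheme \<Rightarrow>
    ('k, 'c, 'p) module_scheme \<Rightarrow> ('a \<Rightarrow> 'b \<Rightarrow> 'c) \<Rightarrow> ('a \<times> 'b \<Rightarrow> 'k) set \<Rightarrow> 'c"
  where "tensor_lift K M N P \<beta> =
    (THE h. h \<in> linear_maps K (tensor_product K M N) P \<and>
            h \<in> extensional (carrier (tensor_product K M N)) \<and>
            (\<forall>x\<in>carrier M. \<forall>y\<in>carrier N. h (pure_tensor K M N x y) = \<beta> x y))"

definition tensor_map ::
  "('k, 'r) ring_scheme \<Rightarrow> ('k, 'a, 'm) module_scheme \<Rightarrow> ('k, 'b, 'n) module_scheme \<Rightarrow>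
    ('k, 'c, 'p) module_scheme \<Rightarrow> ('k, 'd, 'q) module_scheme \<Rightarrow> ('a \<Rightarrow> 'c) \<Rightarrow> ('b \<Rightarrow> 'd) \<Rightarrow>
    ('a \<times> 'b \<Rightarrow> 'k) set \<Rightarrow> ('c \<times> 'd \<Rightarrow> 'k) set"
  where "tensor_map K M N M' N' f g =
    tensor_lift K M N (tensor_product K M' N') (\<lambda>x y. pure_tensor K M' N' (f x) (g y))"

text \<open>The canonical isomorphism from \<open>(L \<otimes> M) \<otimes> N\<close> to \<open>L \<otimes> (M \<otimes> N)\<close>, needed because
  iterated tensor products are not literally associative.\<close>

definition tensor_assoc ::
  "('k, 'r) ring_scheme \<Rightarrow> ('k, 'a, 'm) module_scheme \<Rightarrow> ('k, 'b, 'n) module_scheme \<Rightarrow>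
    ('k, 'c, 'p) module_scheme \<Rightarrow> (('a \<times> 'b \<Rightarrow> 'k) set \<times> 'c \<Rightarrow> 'k) set \<Rightarrow>
    ('a \<times> ('b \<times> 'c \<Rightarrow> 'k) set \<Rightarrow> 'k) set"
  where "tensor_assoc K L M N =
    tensor_lift K (tensor_product K L M) N (tensor_product K L (tensor_product K M N))
      (\<lambda>t z. tensor_lift K L M (tensor_product K L (tensor_product K M N))
               (\<lambda>x y. pure_tensor K L (tensor_product K M N) x (pure_tensor K M N y z)) t)"

section \<open>The universal property\<close>

lemma free_module_simps:
  "carrier (free_module K S) = {c. (\<forall>s\<in>S. c s \<in> carrier K) \<and> (\<forall>s. s \<notin> S \<longrightarrow> c s = \<zero>\<^bsub>K\<^esub>) \<and>
                   finite {s. c s \<noteq> \<zero>\<^bsub>K\<^esub>}}"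
  "\<zero>\<^bsub>free_module K S\<^esub> = (\<lambda>s. \<zero>\<^bsub>K\<^esub>)"
  "c \<oplus>\<^bsub>free_module K S\<^esub> d = (\<lambda>s. c s \<oplus>\<^bsub>K\<^esub> d s)"
  "r \<odot>\<^bsub>free_module K S\<^esub> c = (\<lambda>s. r \<otimes>\<^bsub>K\<^esub> c s)"
  by (simp_all add: free_module_def)

lemma free_module_carrier_coeff:
  assumes "cring K" "c \<in> carrier (free_module K S)"
  shows "c s \<in> carrier K"
proof -
  interpret cring K by fact
  show ?thesis using assms(2) by (cases "s \<in> S") (auto simp: free_module_simps)
qed

lemma free_module_module:
  assumes "cring K"
  shows "module K (free_module K S)"
proof -
  interpret cring K by fact
  let ?F = "free_module K S"
  note cK = free_module_carrier_coeff[OF assms, where S = S]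
  have FI: "c \<in> carrier ?F" if "\<And>s. c s \<in> carrier K" "\<And>s. s \<notin> S \<Longrightarrow> c s = \<zero>\<^bsub>K\<^esub>"
    "{s. c s \<noteq> \<zero>\<^bsub>K\<^esub>} \<subseteq> T" "finite T" for c T
    using that finite_subset by (auto simp: free_module_simps)
  have FD: "c s = \<zero>\<^bsub>K\<^esub>" "finite {s. c s \<noteq> \<zero>\<^bsub>K\<^esub>}" if "c \<in> carrier ?F" "s \<notin> S" for c s
    using that by (simp_all add: free_module_simps)
  have fin: "finite {s. c s \<noteq> \<zero>\<^bsub>K\<^esub>}" if "c \<in> carrier ?F" for c
    using that by (simp add: free_module_simps)
  have add_cl: "c \<oplus>\<^bsub>?F\<^esub> d \<in> carrier ?F" if cd: "c \<in> carrier ?F" "d \<in> carrier ?F" for c d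
    unfolding free_module_simps(3)
    by (rule FI[where T = "{s. c s \<noteq> \<zero>\<^bsub>K\<^esub>} \<union> {s. d s \<noteq> \<zero>\<^bsub>K\<^esub>}"])
       (use cd in \<open>auto simp: cK FD fin\<close>)
  have smult_cl: "r \<odot>\<^bsub>?F\<^esub> c \<in> carrier ?F" if rc: "r \<in> carrier K" "c \<in> carrier ?F" for r c
    unfolding free_module_simps(4)
    by (rule FI[where T = "{s. c s \<noteq> \<zero>\<^bsub>K\<^esub>}"]) (use rc in \<open>auto simp: cK FD fin\<close>)
  have minus_cl: "(\<lambda>s. \<ominus>\<^bsub>K\<^esub> c s) \<in> carrier ?F" if c: "c \<in> carrier ?F" for c
    by (rule FI[where T = "{s. c s \<noteq> \<zero>\<^bsub>K\<^esub>}"]) (use c in \<open>auto simp: cK FD fin\<close>)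
  have zero_cl: "(\<lambda>s. \<zero>\<^bsub>K\<^esub>) \<in> carrier ?F"
    by (rule FI[where T = "{}"]) auto
  show ?thesis
  proof (rule moduleI)
    show "abelian_group ?F"
    proof (rule abelian_groupI)
      fix c assume c: "c \<in> carrier ?F"
      have "(\<lambda>s. \<ominus>\<^bsub>K\<^esub> c s) \<oplus>\<^bsub>?F\<^esub> c = \<zero>\<^bsub>?F\<^esub>"
        using cK[OF c] by (simp add: free_module_simps(2-) l_neg)
      then show "\<exists>d\<in>carrier ?F. d \<oplus>\<^bsub>?F\<^esub> c = \<zero>\<^bsub>?F\<^esub>" using minus_cl[OF c] by blast
    qed (use add_cl zero_cl in \<open>auto simp: free_module_simps(2-) cK a_ac\<close>)
  qed (use smult_cl in \<open>auto simp: free_module_simps(2-) cK l_distr r_distr m_assoc assms\<close>)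
qed

lemma free_gen_closed:
  assumes "cring K" "s \<in> S"
  shows "free_gen K s \<in> carrier (free_module K S)"
proof -
  interpret cring K by fact
  have "{t. free_gen K s t \<noteq> \<zero>\<^bsub>K\<^esub>} \<subseteq> {s}" by (auto simp: free_gen_def)
  then have "finite {t. free_gen K s t \<noteq> \<zero>\<^bsub>K\<^esub>}" by (rule finite_subset) simp
  then show ?thesis using assms(2) by (auto simp: free_module_simps free_gen_def)
qed

lemma submodule_generated_submodule:
  assumes "module K M" "S \<subseteq> carrier M"
  shows "submodule (submodule_generated K M S) K M"
proof -
  interpret module K M by fact
  have c: "submodule (carrier M) K M" by (rule carrier_is_submodule)
  show ?thesis unfolding submodule_generated_def
  proof (rule submoduleI)
    show "\<Inter>{H. submodule H K M \<and> S \<subseteq> H} \<subseteq> carrier M" using c assms(2) by blast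
    show "\<zero>\<^bsub>M\<^esub> \<in> \<Inter>{H. submodule H K M \<and> S \<subseteq> H}"
      by (auto simp: submodule_def dest!: subgroup.one_closed)
  qed (auto dest: submoduleE(3,4,5))
qed

lemma submodule_generated_superset: "S \<subseteq> submodule_generated K M S"
  by (auto simp: submodule_generated_def)

lemma submodule_generated_minimal:
  "submodule H K M \<Longrightarrow> S \<subseteq> H \<Longrightarrow> submodule_generated K M S \<subseteq> H"
  by (auto simp: submodule_generated_def)

lemma submodule_abelian_subgroup:
  assumes "module K M" "submodule H K M"
  shows "abelian_subgroup H M"
  using assms by (auto intro!: abelian_subgroupI3 additive_subgroupI
      simp: module_def submodule_def)

lemma quotient_module_smult:
  assumes "module K M" "submodule H K M" "r \<in> carrier K" "x \<in> carrier M"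
  shows "r \<odot>\<^bsub>quotient_module M H\<^esub> (H +>\<^bsub>M\<^esub> x) = H +>\<^bsub>M\<^esub> (r \<odot>\<^bsub>M\<^esub> x)"
proof -
  interpret module K M by fact
  interpret abelian_subgroup H M by (rule submodule_abelian_subgroup) fact+
  have eq: "H +>\<^bsub>M\<^esub> (r \<odot>\<^bsub>M\<^esub> y) = H +>\<^bsub>M\<^esub> (r \<odot>\<^bsub>M\<^esub> x)" if y: "y \<in> H +>\<^bsub>M\<^esub> x" for y
  proof -
    obtain h where h: "h \<in> H" "y = h \<oplus>\<^bsub>M\<^esub> x" using y by (auto simp: a_r_coset_def')
    have hM: "h \<in> carrier M" using h a_subset by blast
    have "r \<odot>\<^bsub>M\<^esub> y = r \<odot>\<^bsub>M\<^esub> h \<oplus>\<^bsub>M\<^esub> r \<odot>\<^bsub>M\<^esub> x" using h hM assms by (simp add: smult_r_distr)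
    moreover have "r \<odot>\<^bsub>M\<^esub> h \<in> H" using h assms submoduleE(4) by blast
    ultimately have "r \<odot>\<^bsub>M\<^esub> y \<in> H +>\<^bsub>M\<^esub> (r \<odot>\<^bsub>M\<^esub> x)" by (auto simp: a_r_coset_def')
    then show ?thesis using a_repr_independence a_subgroup assms by (metis smult_closed)
  qed
  have "x \<in> H +>\<^bsub>M\<^esub> x" using assms a_rcos_self by blast
  then have "(\<Union>y\<in>H +>\<^bsub>M\<^esub> x. H +>\<^bsub>M\<^esub> (r \<odot>\<^bsub>M\<^esub> y)) = H +>\<^bsub>M\<^esub> (r \<odot>\<^bsub>M\<^esub> x)"
    by (rule UN_constant_eq) (intro ballI eq)
  then show ?thesis unfolding quotient_module_def module.simps .
qed

lemma quotient_module_simps: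
  "carrier (quotient_module M H) = a_rcosets\<^bsub>M\<^esub> H"
  "\<zero>\<^bsub>quotient_module M H\<^esub> = H"
  "X \<oplus>\<^bsub>quotient_module M H\<^esub> Y = X <+>\<^bsub>M\<^esub> Y"
  by (simp_all add: quotient_module_def)

lemma quotient_module_module:
  assumes "module K M" "submodule H K M"
  shows "module K (quotient_module M H)"
proof -
  interpret module K M by fact
  interpret abelian_subgroup H M by (rule submodule_abelian_subgroup) fact+
  let ?Q = "quotient_module M H"
  have rep: "\<exists>x\<in>carrier M. X = H +>\<^bsub>M\<^esub> x" if "X \<in> carrier ?Q" for X
    using that by (auto simp: quotient_module_simps A_RCOSETS_def')
  note sm = quotient_module_smult[OF assms]
  have zc: "H = H +>\<^bsub>M\<^esub> \<zero>\<^bsub>M\<^esub>" using a_subset by simp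
  have cl: "H +>\<^bsub>M\<^esub> x \<in> carrier ?Q" if "x \<in> carrier M" for x
    using that by (auto simp: quotient_module_simps A_RCOSETS_def')
  have ad: "(H +>\<^bsub>M\<^esub> x) \<oplus>\<^bsub>?Q\<^esub> (H +>\<^bsub>M\<^esub> y) = H +>\<^bsub>M\<^esub> (x \<oplus>\<^bsub>M\<^esub> y)" 
    if "x \<in> carrier M" "y \<in> carrier M" for x y
    using that by (simp add: quotient_module_simps a_rcos_sum)
  show ?thesis
  proof (rule moduleI)
    show "cring K" by (rule R.cring_axioms)
    show "abelian_group ?Q"
    proof (rule abelian_groupI)
      fix X assume "X \<in> carrier ?Q"
      then obtain x where x: "x \<in> carrier M" "X = H +>\<^bsub>M\<^esub> x" using rep by blast
      have "(H +>\<^bsub>M\<^esub> (\<ominus>\<^bsub>M\<^esub> x)) \<oplus>\<^bsub>?Q\<^esub> X = H +>\<^bsub>M\<^esub> \<zero>\<^bsub>M\<^esub>"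
        using x by (simp add: ad M.l_neg del: a_coset_add_zero)
      then show "\<exists>Y\<in>carrier ?Q. Y \<oplus>\<^bsub>?Q\<^esub> X = \<zero>\<^bsub>?Q\<^esub>"
        using x cl zc quotient_module_simps(2) M.a_inv_closed by metis
    next
      fix X assume "X \<in> carrier ?Q"
      then obtain x where x: "x \<in> carrier M" "X = H +>\<^bsub>M\<^esub> x" using rep by blast
      then show "\<zero>\<^bsub>?Q\<^esub> \<oplus>\<^bsub>?Q\<^esub> X = X"
        using ad[OF M.zero_closed x(1)] a_subset by (simp add: quotient_module_simps)
    next
      show "\<zero>\<^bsub>?Q\<^esub> \<in> carrier ?Q" using cl[OF M.zero_closed] a_subset by (simp add: quotient_module_simps)
    qed (auto dest!: rep simp: ad cl M.a_ac)
  qed (auto dest!: rep simp: ad cl sm smult_l_distr smult_r_distr smult_assoc1)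
qed

lemma tensor_relators_subset:
  assumes "module K M" "module K N"
  shows "tensor_relators K M N \<subseteq> carrier (free_module K (carrier M \<times> carrier N))"
proof -
  interpret M: module K M by fact
  interpret N: module K N by fact
  interpret F: module K "free_module K (carrier M \<times> carrier N)"
    by (rule free_module_module) (rule M.R.cring_axioms)
  have "free_gen K (x, y) \<in> carrier (free_module K (carrier M \<times> carrier N))" 
    if "x \<in> carrier M" "y \<in> carrier N" for x y
    using that by (intro free_gen_closed) (auto intro: M.R.cring_axioms)
  then show ?thesis by (auto simp: tensor_relators_def Let_def)
qed

lemma tensor_kernel_submodule:
  assumes "module K M" "module K N"
  shows "submodule (tensor_kernel K M N) K (free_module K (carrier M \<times> carrier N))"
  unfolding tensor_kernel_def
  by (intro submodule_generated_submodule free_module_module tensor_relators_subset assms)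
     (use assms(1) in \<open>simp add: module_def\<close>)

lemma tensor_product_module:
  assumes "module K M" "module K N"
  shows "module K (tensor_product K M N)"
  unfolding tensor_product_def
  by (intro quotient_module_module free_module_module tensor_kernel_submodule assms)
     (use assms(1) in \<open>simp add: module_def\<close>)

lemma linear_mapsI:
  assumes "\<And>x. x \<in> carrier M \<Longrightarrow> f x \<in> carrier N"
    and "\<And>x y. x \<in> carrier M \<Longrightarrow> y \<in> carrier M \<Longrightarrow> f (x \<oplus>\<^bsub>M\<^esub> y) = f x \<oplus>\<^bsub>N\<^esub> f y"
    and "\<And>r x. r \<in> carrier K \<Longrightarrow> x \<in> carrier M \<Longrightarrow> f (r \<odot>\<^bsub>M\<^esub> x) = r \<odot>\<^bsub>N\<^esub> f x"
  shows "f \<in> linear_maps K M N"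
  using assms by (auto simp: linear_maps_def)

lemma linear_mapsD:
  assumes "f \<in> linear_maps K M N"
  shows "x \<in> carrier M \<Longrightarrow> f x \<in> carrier N"
    and "x \<in> carrier M \<Longrightarrow> y \<in> carrier M \<Longrightarrow> f (x \<oplus>\<^bsub>M\<^esub> y) = f x \<oplus>\<^bsub>N\<^esub> f y"
    and "r \<in> carrier K \<Longrightarrow> x \<in> carrier M \<Longrightarrow> f (r \<odot>\<^bsub>M\<^esub> x) = r \<odot>\<^bsub>N\<^esub> f x"
  using assms by (auto simp: linear_maps_def)

lemma linear_maps_zero:
  assumes "module K M" "module K N" "f \<in> linear_maps K M N"
  shows "f \<zero>\<^bsub>M\<^esub> = \<zero>\<^bsub>N\<^esub>"
proof -
  interpret M: module K M by fact
  interpret N: module K N by fact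
  have "f (\<zero>\<^bsub>K\<^esub> \<odot>\<^bsub>M\<^esub> \<zero>\<^bsub>M\<^esub>) = \<zero>\<^bsub>K\<^esub> \<odot>\<^bsub>N\<^esub> f \<zero>\<^bsub>M\<^esub>"
    by (rule linear_mapsD[OF assms(3)]) auto
  then show ?thesis by (simp add: linear_mapsD[OF assms(3)])
qed

lemma linear_maps_minus:
  assumes "module K M" "module K N" "f \<in> linear_maps K M N" "x \<in> carrier M" "y \<in> carrier M"
  shows "f (x \<ominus>\<^bsub>M\<^esub> y) = f x \<ominus>\<^bsub>N\<^esub> f y"
proof -
  interpret M: module K M by fact
  interpret N: module K N by fact
  have "f (\<ominus>\<^bsub>M\<^esub> y) \<oplus>\<^bsub>N\<^esub> f y = \<zero>\<^bsub>N\<^esub>"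
    using linear_mapsD(2)[OF assms(3), of "\<ominus>\<^bsub>M\<^esub> y" y] assms(4,5) linear_maps_zero[OF assms(1-3)]
    by (simp add: M.M.l_neg)
  then have "f (\<ominus>\<^bsub>M\<^esub> y) = \<ominus>\<^bsub>N\<^esub> f y"
    using assms(4,5) linear_mapsD(1)[OF assms(3)] N.M.minus_equality by (metis M.M.a_inv_closed)
  then show ?thesis
    using linear_mapsD(2)[OF assms(3), of x "\<ominus>\<^bsub>M\<^esub> y"] assms(4,5) by (simp add: a_minus_def)
qed

lemma linear_maps_kernel:
  assumes "module K M" "module K N" "f \<in> linear_maps K M N"
  shows "submodule {x \<in> carrier M. f x = \<zero>\<^bsub>N\<^esub>} K M"
proof -
  interpret M: module K M by fact
  interpret N: module K N by fact
  show ?thesis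
  proof (rule M.submoduleI)
    fix a assume "a \<in> {x \<in> carrier M. f x = \<zero>\<^bsub>N\<^esub>}"
    then show "\<ominus>\<^bsub>M\<^esub> a \<in> {x \<in> carrier M. f x = \<zero>\<^bsub>N\<^esub>}"
      using linear_maps_minus[OF assms, of "\<zero>\<^bsub>M\<^esub>" a] linear_maps_zero[OF assms]
      by (simp add: a_minus_def)
  qed (auto simp: linear_mapsD[OF assms(3)] linear_maps_zero[OF assms])
qed

lemma free_module_linear_eqI:
  assumes "cring K" "module K P"
    and f: "f \<in> linear_maps K (free_module K S) P" and g: "g \<in> linear_maps K (free_module K S) P"
    and eq: "\<And>s. s \<in> S \<Longrightarrow> f (free_gen K s) = g (free_gen K s)"
    and c: "c \<in> carrier (free_module K S)"
  shows "f c = g c"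
proof -
  interpret cring K by fact
  let ?F = "free_module K S"
  interpret F: module K ?F by (rule free_module_module) fact
  have "f c = g c" if "finite T" "c \<in> carrier ?F" "{s. c s \<noteq> \<zero>\<^bsub>K\<^esub>} \<subseteq> T" for T c
    using that
  proof (induction T arbitrary: c)
    case empty
    then have "c = \<zero>\<^bsub>?F\<^esub>" by (auto simp: free_module_simps)
    then show ?case 
      using linear_maps_zero[OF F.module_axioms assms(2) f]
        linear_maps_zero[OF F.module_axioms assms(2) g] by simp
  next
    case (insert s T)
    note cK = free_module_carrier_coeff[OF assms(1) insert.prems(1)]
    show ?case
    proof (cases "s \<in> S")
      case True
      let ?d = "c(s := \<zero>\<^bsub>K\<^esub>)"
      have "{t. ?d t \<noteq> \<zero>\<^bsub>K\<^esub>} \<subseteq> {s. c s \<noteq> \<zero>\<^bsub>K\<^esub>}" by auto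
      then have "finite {t. ?d t \<noteq> \<zero>\<^bsub>K\<^esub>}"
        by (rule finite_subset) (use insert.prems(1) in \<open>simp add: free_module_simps\<close>)
      then have d: "?d \<in> carrier ?F"
        using insert.prems(1) by (auto simp: free_module_simps)
      have IH: "f ?d = g ?d" using insert.prems(2) by (intro insert.IH d) auto
      have e: "free_gen K s \<in> carrier ?F" by (rule free_gen_closed) fact+
      have "c = ?d \<oplus>\<^bsub>?F\<^esub> c s \<odot>\<^bsub>?F\<^esub> free_gen K s"
        using cK by (auto simp: free_module_simps(2-) free_gen_def fun_eq_iff)
      then obtain d where "f d = g d" "d \<in> carrier ?F" "c = d \<oplus>\<^bsub>?F\<^esub> c s \<odot>\<^bsub>?F\<^esub> free_gen K s"
        using d IH by blast
      then show ?thesis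
        using linear_mapsD[OF f] linear_mapsD[OF g] e cK eq[OF True] F.smult_closed by metis
    next
      case False
      then have "c s = \<zero>\<^bsub>K\<^esub>" using insert.prems(1) by (simp add: free_module_simps)
      then show ?thesis using insert by blast
    qed
  qed
  then show ?thesis using c by (auto simp: free_module_simps)
qed

lemma free_module_lift:
  assumes "module K P" and g: "g \<in> S \<rightarrow> carrier P"
  obtains f where "f \<in> linear_maps K (free_module K S) P" "\<And>s. s \<in> S \<Longrightarrow> f (free_gen K s) = g s"
proof -
  interpret P: module K P by fact
  let ?F = "free_module K S"
  have gP: "g s \<in> carrier P" if "s \<in> S" for s using g that by auto
  define f where "f c = (\<Oplus>\<^bsub>P\<^esub>s\<in>{s. c s \<noteq> \<zero>\<^bsub>K\<^esub>}. c s \<odot>\<^bsub>P\<^esub> g s)" for c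
  note cK = free_module_carrier_coeff[OF P.R.cring_axioms]
  have supp: "{s. c s \<noteq> \<zero>\<^bsub>K\<^esub>} \<subseteq> S" "finite {s. c s \<noteq> \<zero>\<^bsub>K\<^esub>}" if "c \<in> carrier ?F" for c
    using that by (auto simp: free_module_simps)
  have f_eq: "f c = (\<Oplus>\<^bsub>P\<^esub>s\<in>T. c s \<odot>\<^bsub>P\<^esub> g s)"
    if "c \<in> carrier ?F" "finite T" "T \<subseteq> S" "{s. c s \<noteq> \<zero>\<^bsub>K\<^esub>} \<subseteq> T" for c T
    unfolding f_def
  proof (rule P.add.finprod_mono_neutral_cong_left)
    show "(\<lambda>s. c s \<odot>\<^bsub>P\<^esub> g s) \<in> T \<rightarrow> carrier P"
      using that gP cK by (auto intro!: P.smult_closed)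
  qed (use that gP in auto)
  have "f \<in> linear_maps K ?F P"
  proof (rule linear_mapsI)
    fix c assume c: "c \<in> carrier ?F"
    show "f c \<in> carrier P" unfolding f_def
      using supp(1)[OF c] cK[OF c] gP by (intro P.M.finsum_closed) blast
  next
    fix c d assume c: "c \<in> carrier ?F" and d: "d \<in> carrier ?F"
    let ?T = "{s. c s \<noteq> \<zero>\<^bsub>K\<^esub>} \<union> {s. d s \<noteq> \<zero>\<^bsub>K\<^esub>}"
    interpret F: module K ?F by (rule free_module_module) (rule P.R.cring_axioms)
    have T: "finite ?T" "?T \<subseteq> S" using supp c d by auto
    have cd: "c \<oplus>\<^bsub>?F\<^esub> d \<in> carrier ?F" using c d by simp
    have "f (c \<oplus>\<^bsub>?F\<^esub> d) = (\<Oplus>\<^bsub>P\<^esub>s\<in>?T. (c \<oplus>\<^bsub>?F\<^esub> d) s \<odot>\<^bsub>P\<^esub> g s)"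
      using cd T by (rule f_eq) (auto simp: free_module_simps)
    also have "\<dots> = (\<Oplus>\<^bsub>P\<^esub>s\<in>?T. c s \<odot>\<^bsub>P\<^esub> g s \<oplus>\<^bsub>P\<^esub> d s \<odot>\<^bsub>P\<^esub> g s)"
      using T cK[OF c] cK[OF d] gP
      by (intro P.M.finsum_cong') (auto simp: free_module_simps(2-) P.smult_l_distr subset_iff)
    also have "\<dots> = (\<Oplus>\<^bsub>P\<^esub>s\<in>?T. c s \<odot>\<^bsub>P\<^esub> g s) \<oplus>\<^bsub>P\<^esub> (\<Oplus>\<^bsub>P\<^esub>s\<in>?T. d s \<odot>\<^bsub>P\<^esub> g s)"
      using T cK[OF c] cK[OF d] gP
      by (intro P.M.finsum_addf) (auto simp: subset_iff)
    also have "\<dots> = f c \<oplus>\<^bsub>P\<^esub> f d"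
      using f_eq[OF c T] f_eq[OF d T] by auto
    finally show "f (c \<oplus>\<^bsub>?F\<^esub> d) = f c \<oplus>\<^bsub>P\<^esub> f d" .
  next
    fix r c assume r: "r \<in> carrier K" and c: "c \<in> carrier ?F"
    let ?T = "{s. c s \<noteq> \<zero>\<^bsub>K\<^esub>}"
    interpret F: module K ?F by (rule free_module_module) (rule P.R.cring_axioms)
    have T: "finite ?T" "?T \<subseteq> S" using supp c by auto
    have rc: "r \<odot>\<^bsub>?F\<^esub> c \<in> carrier ?F" using r c by simp
    have "f (r \<odot>\<^bsub>?F\<^esub> c) = (\<Oplus>\<^bsub>P\<^esub>s\<in>?T. (r \<odot>\<^bsub>?F\<^esub> c) s \<odot>\<^bsub>P\<^esub> g s)"
      using rc T by (rule f_eq) (use r in \<open>auto simp: free_module_simps\<close>)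
    also have "\<dots> = (\<Oplus>\<^bsub>P\<^esub>s\<in>?T. r \<odot>\<^bsub>P\<^esub> (c s \<odot>\<^bsub>P\<^esub> g s))"
      using T cK[OF c] gP r
      by (intro P.M.finsum_cong') (auto simp: free_module_simps(2-) P.smult_assoc1 subset_iff)
    also have "\<dots> = r \<odot>\<^bsub>P\<^esub> f c"
      unfolding f_def using T cK[OF c] gP r
      by (intro P.finsum_smult_ldistr[symmetric]) (auto simp: subset_iff)
    finally show "f (r \<odot>\<^bsub>?F\<^esub> c) = r \<odot>\<^bsub>P\<^esub> f c" .
  qed
  moreover have "f (free_gen K s) = g s" if s: "s \<in> S" for s
  proof -
    have e: "free_gen K s \<in> carrier ?F" by (rule free_gen_closed[OF P.R.cring_axioms s])
    have "f (free_gen K s) = (\<Oplus>\<^bsub>P\<^esub>t\<in>{s}. free_gen K s t \<odot>\<^bsub>P\<^esub> g t)"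
      using e by (rule f_eq) (use s in \<open>auto simp: free_gen_def\<close>)
    then show ?thesis using s gP by (simp add: free_gen_def)
  qed
  ultimately show ?thesis using that by blast
qed

lemma quotient_module_proj:
  assumes "module K M" "submodule H K M"
  shows "(\<lambda>x. H +>\<^bsub>M\<^esub> x) \<in> linear_maps K M (quotient_module M H)"
proof -
  interpret module K M by fact
  interpret abelian_subgroup H M by (rule submodule_abelian_subgroup) fact+
  show ?thesis
    by (rule linear_mapsI)
       (auto simp: quotient_module_smult[OF assms] quotient_module_simps a_rcos_sum A_RCOSETS_def')
qed

lemma tensor_proj:
  assumes "module K M" "module K N"
  shows "(\<lambda>c. tensor_kernel K M N +>\<^bsub>free_module K (carrier M \<times> carrier N)\<^esub> c)
    \<in> linear_maps K (free_module K (carrier M \<times> carrier N)) (tensor_product K M N)"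
  unfolding tensor_product_def
  by (intro quotient_module_proj free_module_module tensor_kernel_submodule assms)
     (use assms(1) in \<open>simp add: module_def\<close>)

lemma tensor_proj_eqI:
  assumes "module K M" "module K N"
    and "c \<in> carrier (free_module K (carrier M \<times> carrier N))"
    and "d \<in> carrier (free_module K (carrier M \<times> carrier N))"
    and "c \<ominus>\<^bsub>free_module K (carrier M \<times> carrier N)\<^esub> d \<in> tensor_relators K M N"
  shows "tensor_kernel K M N +>\<^bsub>free_module K (carrier M \<times> carrier N)\<^esub> c =
         tensor_kernel K M N +>\<^bsub>free_module K (carrier M \<times> carrier N)\<^esub> d"
proof -
  let ?F = "free_module K (carrier M \<times> carrier N)" let ?H = "tensor_kernel K M N"
  have "cring K" using assms(1) by (simp add: module_def)
  then interpret F: module K ?F by (rule free_module_module)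
  interpret abelian_subgroup ?H ?F
    by (rule submodule_abelian_subgroup[OF F.module_axioms tensor_kernel_submodule[OF assms(1,2)]])
  have "c \<ominus>\<^bsub>?F\<^esub> d \<in> ?H"
    unfolding tensor_kernel_def by (rule subsetD[OF submodule_generated_superset assms(5)])
  moreover have "c = (c \<ominus>\<^bsub>?F\<^esub> d) \<oplus>\<^bsub>?F\<^esub> d"
    using assms(3,4) by (simp add: a_minus_def F.M.a_assoc F.M.l_neg)
  ultimately have "c \<in> ?H +>\<^bsub>?F\<^esub> d" by (auto simp: a_r_coset_def')
  then show ?thesis using F.M.a_repr_independence a_subgroup assms(4) by metis
qed

lemma pure_tensor_bilinear:
  assumes "module K M" "module K N"
  shows "pure_tensor K M N \<in> bilinear_maps K M N (tensor_product K M N)"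
proof -
  let ?F = "free_module K (carrier M \<times> carrier N)" let ?H = "tensor_kernel K M N"
  have K: "cring K" using assms(1) by (simp add: module_def)
  interpret M: module K M by fact
  interpret N: module K N by fact
  interpret F: module K ?F by (rule free_module_module) fact
  note proj = linear_mapsD[OF tensor_proj[OF assms]]
  have e: "free_gen K (x, y) \<in> carrier ?F" if "x \<in> carrier M" "y \<in> carrier N" for x y
    using that by (intro free_gen_closed K) auto
  note rel = tensor_proj_eqI[OF assms]
  have r1: "free_gen K (x \<oplus>\<^bsub>M\<^esub> x', y) \<ominus>\<^bsub>?F\<^esub> (free_gen K (x, y) \<oplus>\<^bsub>?F\<^esub> free_gen K (x', y))
      \<in> tensor_relators K M N" if "x \<in> carrier M" "x' \<in> carrier M" "y \<in> carrier N" for x x' y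
    unfolding tensor_relators_def Let_def using that by blast
  have r2: "free_gen K (x, y \<oplus>\<^bsub>N\<^esub> y') \<ominus>\<^bsub>?F\<^esub> (free_gen K (x, y) \<oplus>\<^bsub>?F\<^esub> free_gen K (x, y'))
      \<in> tensor_relators K M N" if "x \<in> carrier M" "y \<in> carrier N" "y' \<in> carrier N" for x y y'
    unfolding tensor_relators_def Let_def using that by blast
  have "pure_tensor K M N x y \<in> carrier (tensor_product K M N)"
    if "x \<in> carrier M" "y \<in> carrier N" for x y
    unfolding pure_tensor_def using that e by (intro proj)
  moreover have "pure_tensor K M N (x \<oplus>\<^bsub>M\<^esub> x') y =
      pure_tensor K M N x y \<oplus>\<^bsub>tensor_product K M N\<^esub> pure_tensor K M N x' y"
    if "x \<in> carrier M" "x' \<in> carrier M" "y \<in> carrier N" for x x' y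
    unfolding pure_tensor_def
    by (subst proj(2)[symmetric], (use that e in simp)+, rule rel[OF _ _ r1],
        use that e in simp_all)
  moreover have "pure_tensor K M N x (y \<oplus>\<^bsub>N\<^esub> y') =
      pure_tensor K M N x y \<oplus>\<^bsub>tensor_product K M N\<^esub> pure_tensor K M N x y'"
    if "x \<in> carrier M" "y \<in> carrier N" "y' \<in> carrier N" for x y y'
    unfolding pure_tensor_def
    by (subst proj(2)[symmetric], (use that e in simp)+, rule rel[OF _ _ r2],
        use that e in simp_all)
  moreover have "pure_tensor K M N (r \<odot>\<^bsub>M\<^esub> x) y = r \<odot>\<^bsub>tensor_product K M N\<^esub> pure_tensor K M N x y"
    if "r \<in> carrier K" "x \<in> carrier M" "y \<in> carrier N" for r x y
    unfolding pure_tensor_def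
    by (subst proj(3)[symmetric], (use that e in simp)+, rule rel,
        use that e in \<open>auto simp: tensor_relators_def Let_def\<close>)
  moreover have "pure_tensor K M N x (r \<odot>\<^bsub>N\<^esub> y) = r \<odot>\<^bsub>tensor_product K M N\<^esub> pure_tensor K M N x y"
    if "r \<in> carrier K" "x \<in> carrier M" "y \<in> carrier N" for r x y
    unfolding pure_tensor_def
    by (subst proj(3)[symmetric], (use that e in simp)+, rule rel,
        use that e in \<open>auto simp: tensor_relators_def Let_def\<close>)
  ultimately show ?thesis
    unfolding bilinear_maps_def by (auto intro!: linear_mapsI)
qed

lemma tensor_universal:
  assumes "module K M" "module K N" "module K P" and \<beta>: "\<beta> \<in> bilinear_maps K M N P"
  shows "\<exists>!h. h \<in> linear_maps K (tensor_product K M N) P \<and>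
            h \<in> extensional (carrier (tensor_product K M N)) \<and>
            (\<forall>x\<in>carrier M. \<forall>y\<in>carrier N. h (pure_tensor K M N x y) = \<beta> x y)"
proof -
  let ?F = "free_module K (carrier M \<times> carrier N)" let ?H = "tensor_kernel K M N"
  let ?T = "tensor_product K M N"
  have K: "cring K" using assms(1) by (simp add: module_def)
  interpret M: module K M by fact
  interpret N: module K N by fact
  interpret P: module K P by fact
  interpret F: module K ?F by (rule free_module_module) fact
  interpret abelian_subgroup ?H ?F
    by (rule submodule_abelian_subgroup[OF F.module_axioms tensor_kernel_submodule[OF assms(1,2)]])
  define \<pi> where "\<pi> c = ?H +>\<^bsub>?F\<^esub> c" for c
  have \<pi>: "\<pi> \<in> linear_maps K ?F ?T"
    using tensor_proj[OF assms(1,2)] unfolding \<pi>_def .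
  have \<pi>_surj: "\<exists>c\<in>carrier ?F. X = \<pi> c" if "X \<in> carrier ?T" for X
    using that by (auto simp: tensor_product_def quotient_module_simps A_RCOSETS_def' \<pi>_def)
  have e: "free_gen K (x, y) \<in> carrier ?F" if "x \<in> carrier M" "y \<in> carrier N" for x y
    using that by (intro free_gen_closed K) auto
  have \<beta>1: "\<beta> x \<in> linear_maps K N P" if "x \<in> carrier M" for x
    using \<beta> that by (simp add: bilinear_maps_def)
  have \<beta>2: "(\<lambda>x. \<beta> x y) \<in> linear_maps K M P" if "y \<in> carrier N" for y
    using \<beta> that by (simp add: bilinear_maps_def)
  note b1 = linear_mapsD[OF \<beta>1] and b2 = linear_mapsD[OF \<beta>2]
  obtain f where f: "f \<in> linear_maps K ?F P"
    and f_gen: "\<And>s. s \<in> carrier M \<times> carrier N \<Longrightarrow> f (free_gen K s) = \<beta> (fst s) (snd s)"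
    by (rule free_module_lift[OF assms(3), of "\<lambda>s. \<beta> (fst s) (snd s)" "carrier M \<times> carrier N"])
       (auto simp: b1)
  note fD = linear_mapsD[OF f] linear_maps_minus[OF F.module_axioms assms(3) f]
  have "?H \<subseteq> {c \<in> carrier ?F. f c = \<zero>\<^bsub>P\<^esub>}"
    unfolding tensor_kernel_def
  proof (rule submodule_generated_minimal)
    show "submodule {c \<in> carrier ?F. f c = \<zero>\<^bsub>P\<^esub>} K ?F"
      by (rule linear_maps_kernel[OF F.module_axioms assms(3) f])
    show "tensor_relators K M N \<subseteq> {c \<in> carrier ?F. f c = \<zero>\<^bsub>P\<^esub>}"
    proof
      fix c assume c: "c \<in> tensor_relators K M N"
      have f0: "f (c \<ominus>\<^bsub>?F\<^esub> d) = \<zero>\<^bsub>P\<^esub>" if "c \<in> carrier ?F" "d \<in> carrier ?F" "f c = f d" for c d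
        using that fD(1)[of d] fD(4)[of c d] by (simp add: a_minus_def P.M.r_neg)
      have "f c = \<zero>\<^bsub>P\<^esub>"
        using c unfolding tensor_relators_def Let_def
        by (auto intro!: f0 simp: fD(1-3) f_gen e b1 b2)
      then show "c \<in> {c \<in> carrier ?F. f c = \<zero>\<^bsub>P\<^esub>}"
        using c tensor_relators_subset[OF assms(1,2)] by blast
    qed
  qed
  then have f_ker: "f c = \<zero>\<^bsub>P\<^esub>" if "c \<in> ?H" for c using that by blast
  have f_wd: "f c = f d" if "\<pi> c = \<pi> d" "c \<in> carrier ?F" "d \<in> carrier ?F" for c d
  proof -
    have "c \<in> ?H +>\<^bsub>?F\<^esub> d" using that a_rcos_self unfolding \<pi>_def by blast
    then obtain h where h: "h \<in> ?H" "c = h \<oplus>\<^bsub>?F\<^esub> d" by (auto simp: a_r_coset_def')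
    then have "h \<in> carrier ?F" using a_subset by blast
    then show ?thesis using h that f_ker fD by simp
  qed
  define h where "h = (\<lambda>X\<in>carrier ?T. f (SOME c. c \<in> carrier ?F \<and> \<pi> c = X))"
  have h: "h (\<pi> c) = f c" if "c \<in> carrier ?F" for c
  proof -
    let ?d = "SOME d. d \<in> carrier ?F \<and> \<pi> d = \<pi> c"
    have "?d \<in> carrier ?F \<and> \<pi> ?d = \<pi> c" by (rule someI[of _ c]) (simp add: that)
    then have "f ?d = f c" using f_wd that by blast
    then show ?thesis using linear_mapsD(1)[OF \<pi> that] by (simp add: h_def)
  qed
  note piD = linear_mapsD[OF \<pi>]
  have "h \<in> linear_maps K ?T P"
    by (rule linear_mapsI)
       (auto dest!: \<pi>_surj simp: h fD piD(2,3)[symmetric])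
  moreover have "h \<in> extensional (carrier ?T)" by (simp add: h_def)
  moreover have "h (pure_tensor K M N x y) = \<beta> x y" if "x \<in> carrier M" "y \<in> carrier N" for x y
    using h[OF e] f_gen that by (simp add: pure_tensor_def \<pi>_def)
  moreover have "h1 = h2"
    if h1: "h1 \<in> linear_maps K ?T P" "h1 \<in> extensional (carrier ?T)"
        "\<forall>x\<in>carrier M. \<forall>y\<in>carrier N. h1 (pure_tensor K M N x y) = \<beta> x y"
      and h2: "h2 \<in> linear_maps K ?T P" "h2 \<in> extensional (carrier ?T)"
        "\<forall>x\<in>carrier M. \<forall>y\<in>carrier N. h2 (pure_tensor K M N x y) = \<beta> x y"
    for h1 h2
  proof (rule extensionalityI[OF h1(2) h2(2)])
    fix X assume "X \<in> carrier ?T"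
    then obtain c where c: "c \<in> carrier ?F" "X = \<pi> c" using \<pi>_surj by blast
    have lin: "(\<lambda>c. k (\<pi> c)) \<in> linear_maps K ?F P" if "k \<in> linear_maps K ?T P" for k
      by (rule linear_mapsI) (simp_all add: piD linear_mapsD[OF that])
    have "h1 (\<pi> c) = h2 (\<pi> c)"
      by (rule free_module_linear_eqI[OF K assms(3) lin[OF h1(1)] lin[OF h2(1)] _ c(1)])
         (use h1(3) h2(3) in \<open>auto simp: pure_tensor_def \<pi>_def\<close>)
    then show "h1 X = h2 X" using c by simp
  qed
  ultimately show ?thesis by blast
qed

lemma tensor_lift:
  assumes "module K M" "module K N" "module K P" "\<beta> \<in> bilinear_maps K M N P"
  shows tensor_lift_linear: "tensor_lift K M N P \<beta> \<in> linear_maps K (tensor_product K M N) P"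
    and tensor_lift_pure:
      "x \<in> carrier M \<Longrightarrow> y \<in> carrier N \<Longrightarrow>
        tensor_lift K M N P \<beta> (pure_tensor K M N x y) = \<beta> x y"
  using theI'[OF tensor_universal[OF assms], folded tensor_lift_def] by blast+

section \<open>Hom-bialgebras\<close>

locale tensor_square = module K A for K (structure) and A (structure)
begin

abbreviation AA where "AA \<equiv> tensor_product K A A"

abbreviation tensor (infixl \<open>\<boxtimes>\<close> 75) where "x \<boxtimes> y \<equiv> pure_tensor K A A x y"

text \<open>Sweedler sums: if \<open>t = \<Sum> x\<^sub>1 \<otimes> x\<^sub>2\<close>, then \<open>sweedler P t \<beta>\<close> is \<open>\<Sum> \<beta> x\<^sub>1 x\<^sub>2\<close>, computed in \<open>P\<close>.\<close>

abbreviation sweedler where "sweedler P t \<beta> \<equiv> tensor_lift K A A P \<beta> t"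

end

locale hom_bialgebra = tensor_square K A for K (structure) and A (structure) +
  fixes \<mu> \<Delta> \<alpha>
  assumes mult_linear: "\<mu> \<in> linear_maps K AA A"
    and comult_linear: "\<Delta> \<in> linear_maps K A AA"
    and twist_linear: "\<alpha> \<in> linear_maps K A A"
    and twist_mult: "\<And>t. t \<in> carrier AA \<Longrightarrow> \<alpha> (\<mu> t) = \<mu> (tensor_map K A A A A \<alpha> \<alpha> t)"
    and hom_assoc: "\<And>t. t \<in> carrier (tensor_product K AA A) \<Longrightarrow>
      \<mu> (tensor_map K A AA A A \<alpha> \<mu> (tensor_assoc K A A A t)) = \<mu> (tensor_map K AA A A A \<mu> \<alpha> t)"
    and twist_comult: "\<And>x. x \<in> carrier A \<Longrightarrow> tensor_map K A A A A \<alpha> \<alpha> (\<Delta> x) = \<Delta> (\<alpha> x)"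
    and hom_coassoc: "\<And>x. x \<in> carrier A \<Longrightarrow>
      tensor_map K A A A AA \<alpha> \<Delta> (\<Delta> x) = tensor_assoc K A A A (tensor_map K A A AA A \<Delta> \<alpha> (\<Delta> x))"
    and comult_mult: "\<And>a b. a \<in> carrier A \<Longrightarrow> b \<in> carrier A \<Longrightarrow>
      \<Delta> (\<mu> (a \<boxtimes> b)) =
        sweedler AA (\<Delta> a) (\<lambda>a1 a2. sweedler AA (\<Delta> b) (\<lambda>b1 b2. \<mu> (a1 \<boxtimes> b1) \<boxtimes> \<mu> (a2 \<boxtimes> b2)))"

locale cobraided_hom_bialgebra = hom_bialgebra K A \<mu> \<Delta> \<alpha>
  for K (structure) and A (structure) and \<mu> \<Delta> \<alpha> +
  fixes R
  assumes form_linear: "R \<in> linear_maps K AA (ring_as_module K)"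
    and form_mult_left: "\<And>x y z. x \<in> carrier A \<Longrightarrow> y \<in> carrier A \<Longrightarrow> z \<in> carrier A \<Longrightarrow>
      R (\<mu> (x \<boxtimes> y) \<boxtimes> \<alpha> z) =
        sweedler (ring_as_module K) (\<Delta> z) (\<lambda>z1 z2. R (\<alpha> x \<boxtimes> z1) \<otimes> R (\<alpha> y \<boxtimes> z2))"
    and form_mult_right: "\<And>x y z. x \<in> carrier A \<Longrightarrow> y \<in> carrier A \<Longrightarrow> z \<in> carrier A \<Longrightarrow>
      R (\<alpha> x \<boxtimes> \<mu> (y \<boxtimes> z)) =
        sweedler (ring_as_module K) (\<Delta> x) (\<lambda>x1 x2. R (x1 \<boxtimes> \<alpha> z) \<otimes> R (x2 \<boxtimes> \<alpha> y))"
    and form_commute: "\<And>x y. x \<in> carrier A \<Longrightarrow> y \<in> carrier A \<Longrightarrow>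
      sweedler A (\<Delta> x) (\<lambda>x1 x2. sweedler A (\<Delta> y) (\<lambda>y1 y2. R (x2 \<boxtimes> y2) \<odot>\<^bsub>A\<^esub> \<mu> (y1 \<boxtimes> x1))) =
      sweedler A (\<Delta> x) (\<lambda>x1 x2. sweedler A (\<Delta> y) (\<lambda>y1 y2. R (x1 \<boxtimes> y1) \<odot>\<^bsub>A\<^esub> \<mu> (x2 \<boxtimes> y2)))"

abbreviation bialgebra where
  "bialgebra K A \<mu> \<Delta> \<equiv> hom_bialgebra K A \<mu> \<Delta> id"

abbreviation cobraided_bialgebra where
  "cobraided_bialgebra K A \<mu> \<Delta> R \<equiv> cobraided_hom_bialgebra K A \<mu> \<Delta> id R"

definition bialgebra_morphisms where
  "bialgebra_morphisms K A \<mu>\<^sub>A \<Delta>\<^sub>A B \<mu>\<^sub>B \<Delta>\<^sub>B =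
    {f \<in> linear_maps K A B.
      (\<forall>t\<in>carrier (tensor_product K A A). f (\<mu>\<^sub>A t) = \<mu>\<^sub>B (tensor_map K A A B B f f t)) \<and>
      (\<forall>x\<in>carrier A. tensor_map K A A B B f f (\<Delta>\<^sub>A x) = \<Delta>\<^sub>B (f x))}"

end

theory Submission
  imports Defs
begin

text \<open>
  Yau's twisting principle: each axiom of \<open>A\<^sub>\<alpha>\<close> is the corresponding untwisted axiom, evaluated at
  elements of the form \<open>\<alpha> x\<close> or \<open>\<alpha> (\<alpha> x)\<close>, or transported along a linear map built from \<open>\<alpha>\<close>. The
  reason is that a bialgebra morphism can be moved freely across \<open>\<mu>\<close> and \<open>\<Delta>\<close>:
  \<open>\<alpha> \<circ> \<mu> = \<mu> \<circ> (\<alpha> \<otimes> \<alpha>)\<close> and \<open>(\<alpha> \<otimes> \<alpha>) \<circ> \<Delta> = \<Delta> \<circ> \<alpha>\<close>.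

  For Hom-associativity, \<open>\<alpha> \<otimes> (\<alpha> \<circ> \<mu>) = (\<alpha> \<otimes> \<alpha>) \<circ> (id \<otimes> \<mu>)\<close>, so both sides become \<open>\<alpha>\<^sup>2\<close> applied to
  the two sides of ordinary associativity; Hom-coassociativity is dually coassociativity evaluated
  at \<open>\<alpha>\<^sup>2 x\<close>. The two multiplicativity axioms of \<open>R\<close> for \<open>x, y, z\<close> are the untwisted ones for
  \<open>\<alpha> x, \<alpha> y, \<alpha> z\<close>, since \<open>\<Delta>\<^sub>\<alpha> z = \<Delta> (\<alpha> z)\<close> and \<open>\<alpha> (\<mu> (x \<otimes> y)) = \<mu> (\<alpha> x \<otimes> \<alpha> y)\<close>.

  Two axioms equate nested Sweedler sums with values in a module: the compatibility of \<open>\<Delta>\<close> with \<open>\<mu>\<close>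
  and the commutation relation of \<open>R\<close>. These are the untwisted identities at \<open>\<alpha>\<close>-images to which
  \<open>\<alpha> \<otimes> \<alpha>\<close>, respectively \<open>\<alpha>\<close>, is applied. Everything there rests on \<open>linear_map_double_sweedler\<close>: a
  linear map may be pulled inside a double Sweedler sum of a quadrilinear expression.
\<close>

section \<open>Linear and bilinear maps\<close>

lemma linear_maps_id: "id \<in> linear_maps K M M"
  by (simp add: linear_maps_def)

lemma linear_maps_comp:
  assumes "g \<in> linear_maps K N P" "f \<in> linear_maps K M N"
  shows "(\<lambda>x. g (f x)) \<in> linear_maps K M P"
  using assms by (auto simp: linear_maps_def Pi_iff)

lemma linear_maps_add:
  assumes "module K P" and f: "f \<in> linear_maps K M P" and g: "g \<in> linear_maps K M P"
  shows "(\<lambda>x. f x \<oplus>\<^bsub>P\<^esub> g x) \<in> linear_maps K M P"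
proof -
  interpret P: module K P by fact
  note fD = linear_mapsD[OF f] and gD = linear_mapsD[OF g]
  show ?thesis
    by (rule linear_mapsI) (simp_all add: fD gD P.smult_r_distr P.M.a_ac)
qed

lemma linear_maps_smult:
  assumes "module K P" and f: "f \<in> linear_maps K M P" and "r \<in> carrier K"
  shows "(\<lambda>x. r \<odot>\<^bsub>P\<^esub> f x) \<in> linear_maps K M P"
proof -
  interpret P: module K P by fact
  note fD = linear_mapsD[OF f]
  show ?thesis
    using assms(3)
    by (intro linear_mapsI)
       (simp_all add: fD P.smult_r_distr P.smult_assoc1[symmetric] P.R.m_comm)
qed

lemma bilinear_mapsI:
  assumes "\<And>x. x \<in> carrier M \<Longrightarrow> \<beta> x \<in> linear_maps K N P"
    and "\<And>y. y \<in> carrier N \<Longrightarrow> (\<lambda>x. \<beta> x y) \<in> linear_maps K M P"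
  shows "\<beta> \<in> bilinear_maps K M N P"
  using assms by (simp add: bilinear_maps_def)

lemma bilinear_mapsD:
  assumes "\<beta> \<in> bilinear_maps K M N P"
  shows "x \<in> carrier M \<Longrightarrow> \<beta> x \<in> linear_maps K N P"
    and "y \<in> carrier N \<Longrightarrow> (\<lambda>x. \<beta> x y) \<in> linear_maps K M P"
  using assms by (simp_all add: bilinear_maps_def)

lemma bilinear_maps_comp:
  assumes "\<beta> \<in> bilinear_maps K M' N' P" "f \<in> linear_maps K M M'" "g \<in> linear_maps K N N'"
  shows "(\<lambda>x y. \<beta> (f x) (g y)) \<in> bilinear_maps K M N P"
  by (intro bilinear_mapsI linear_maps_comp[OF bilinear_mapsD(1)[OF assms(1)] assms(3)]
      linear_maps_comp[OF bilinear_mapsD(2)[OF assms(1)] assms(2)]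
      linear_mapsD(1)[OF assms(2)] linear_mapsD(1)[OF assms(3)])

lemma bilinear_maps_post:
  assumes "f \<in> linear_maps K P Q" "\<beta> \<in> bilinear_maps K M N P"
  shows "(\<lambda>x y. f (\<beta> x y)) \<in> bilinear_maps K M N Q"
  by (intro bilinear_mapsI linear_maps_comp[OF assms(1)] bilinear_mapsD[OF assms(2)])

lemma bilinear_maps_flip:
  assumes "\<beta> \<in> bilinear_maps K M N P"
  shows "(\<lambda>y x. \<beta> x y) \<in> bilinear_maps K N M P"
  by (intro bilinear_mapsI bilinear_mapsD[OF assms])

lemma smult_bilinear:
  assumes "module K P"
  shows "(\<lambda>r x. r \<odot>\<^bsub>P\<^esub> x) \<in> bilinear_maps K (ring_as_module K) P P"
proof -
  interpret P: module K P by fact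
  show ?thesis
    by (intro bilinear_mapsI linear_mapsI)
       (simp_all add: ring_as_module_def P.smult_l_distr P.smult_r_distr P.smult_assoc1[symmetric]
          P.R.m_comm)
qed

section \<open>Calculus of induced maps on tensor products\<close>

lemma tensor_lift_cong:
  assumes "\<And>x y. x \<in> carrier M \<Longrightarrow> y \<in> carrier N \<Longrightarrow> \<beta> x y = \<gamma> x y"
  shows "tensor_lift K M N P \<beta> = tensor_lift K M N P \<gamma>"
  unfolding tensor_lift_def using assms by (intro arg_cong[where f = The] ext) auto

lemma pure_tensor_closed:
  assumes "module K M" "module K N" "x \<in> carrier M" "y \<in> carrier N"
  shows "pure_tensor K M N x y \<in> carrier (tensor_product K M N)"
  by (rule linear_mapsD(1)[OF bilinear_mapsD(1)[OF pure_tensor_bilinear[OF assms(1,2)]]]) fact+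

text \<open>Restricting two linear maps to the carrier puts them into the scope of the uniqueness half of
  the universal property, for the bilinear map that both of them induce.\<close>

lemma tensor_linear_eqI:
  assumes "module K M" "module K N" "module K P"
    and f: "f \<in> linear_maps K (tensor_product K M N) P"
    and g: "g \<in> linear_maps K (tensor_product K M N) P"
    and eq: "\<And>x y. x \<in> carrier M \<Longrightarrow> y \<in> carrier N \<Longrightarrow>
      f (pure_tensor K M N x y) = g (pure_tensor K M N x y)"
    and t: "t \<in> carrier (tensor_product K M N)"
  shows "f t = g t"
proof -
  let ?T = "tensor_product K M N"
  interpret T: module K ?T by (rule tensor_product_module) fact+
  let ?\<beta> = "\<lambda>x y. f (pure_tensor K M N x y)"
  have "?\<beta> \<in> bilinear_maps K M N P"
    by (rule bilinear_maps_post[OF f pure_tensor_bilinear]) fact+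
  note uniq = tensor_universal[OF assms(1-3) this]
  have restr: "restrict k (carrier ?T) \<in> linear_maps K ?T P" if "k \<in> linear_maps K ?T P" for k
    by (rule linear_mapsI) (simp_all add: linear_mapsD[OF that])
  have "restrict f (carrier ?T) = restrict g (carrier ?T)"
    by (rule trans[OF the1_equality[OF uniq, symmetric] the1_equality[OF uniq]])
       (simp_all add: restr[OF f] restr[OF g] pure_tensor_closed[OF assms(1,2)] eq)
  then show ?thesis using t by (metis restrict_apply')
qed

lemma linear_map_tensor_lift:
  assumes "module K M" "module K N" "module K P" "module K Q"
    and f: "f \<in> linear_maps K P Q" and \<beta>: "\<beta> \<in> bilinear_maps K M N P"
    and t: "t \<in> carrier (tensor_product K M N)"
  shows "f (tensor_lift K M N P \<beta> t) = tensor_lift K M N Q (\<lambda>x y. f (\<beta> x y)) t"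
proof -
  note f\<beta> = bilinear_maps_post[OF f \<beta>]
  show ?thesis
    by (rule tensor_linear_eqI[OF assms(1,2,4) linear_maps_comp[OF f tensor_lift_linear]
          tensor_lift_linear _ t])
       (simp_all add: assms(1-4) \<beta> f\<beta> tensor_lift_pure)
qed

text \<open>Lifts depend linearly on the bilinear map, because sums and scalar multiples of lifts are
  linear maps with the right values on pure tensors.\<close>

lemma tensor_lift_add:
  assumes "module K M" "module K N" "module K P"
    and \<beta>: "\<beta> \<in> bilinear_maps K M N P" and \<gamma>: "\<gamma> \<in> bilinear_maps K M N P"
    and \<delta>: "\<delta> \<in> bilinear_maps K M N P"
    and eq: "\<And>x y. x \<in> carrier M \<Longrightarrow> y \<in> carrier N \<Longrightarrow> \<delta> x y = \<beta> x y \<oplus>\<^bsub>P\<^esub> \<gamma> x y"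
    and t: "t \<in> carrier (tensor_product K M N)"
  shows "tensor_lift K M N P \<delta> t = tensor_lift K M N P \<beta> t \<oplus>\<^bsub>P\<^esub> tensor_lift K M N P \<gamma> t"
  by (rule tensor_linear_eqI[OF assms(1-3) tensor_lift_linear
        linear_maps_add[OF assms(3) tensor_lift_linear tensor_lift_linear] _ t])
     (simp_all add: assms(1-3) \<beta> \<gamma> \<delta> eq tensor_lift_pure)

lemma tensor_lift_smult:
  assumes "module K M" "module K N" "module K P"
    and \<beta>: "\<beta> \<in> bilinear_maps K M N P" and \<delta>: "\<delta> \<in> bilinear_maps K M N P"
    and r: "r \<in> carrier K"
    and eq: "\<And>x y. x \<in> carrier M \<Longrightarrow> y \<in> carrier N \<Longrightarrow> \<delta> x y = r \<odot>\<^bsub>P\<^esub> \<beta> x y"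
    and t: "t \<in> carrier (tensor_product K M N)"
  shows "tensor_lift K M N P \<delta> t = r \<odot>\<^bsub>P\<^esub> tensor_lift K M N P \<beta> t"
  by (rule tensor_linear_eqI[OF assms(1-3) tensor_lift_linear
        linear_maps_smult[OF assms(3) tensor_lift_linear r] _ t])
     (simp_all add: assms(1-3) \<beta> \<delta> eq tensor_lift_pure)

lemma tensor_lift_param_linear:
  assumes "module K M" "module K N" "module K P"
    and \<gamma>: "\<And>u. u \<in> carrier L \<Longrightarrow> \<gamma> u \<in> bilinear_maps K M N P"
    and lin: "\<And>x y. x \<in> carrier M \<Longrightarrow> y \<in> carrier N \<Longrightarrow> (\<lambda>u. \<gamma> u x y) \<in> linear_maps K L P"
    and L: "module K L" and t: "t \<in> carrier (tensor_product K M N)"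
  shows "(\<lambda>u. tensor_lift K M N P (\<gamma> u) t) \<in> linear_maps K L P"
proof -
  interpret L: module K L by fact
  note lD = linear_mapsD[OF lin]
  show ?thesis
  proof (rule linear_mapsI)
    fix u assume "u \<in> carrier L"
    then show "tensor_lift K M N P (\<gamma> u) t \<in> carrier P"
      by (intro linear_mapsD(1)[OF tensor_lift_linear[OF assms(1-3) \<gamma>] t])
  next
    fix u v assume "u \<in> carrier L" "v \<in> carrier L"
    then show "tensor_lift K M N P (\<gamma> (u \<oplus>\<^bsub>L\<^esub> v)) t =
        tensor_lift K M N P (\<gamma> u) t \<oplus>\<^bsub>P\<^esub> tensor_lift K M N P (\<gamma> v) t"
      by (intro tensor_lift_add[OF assms(1-3) \<gamma> \<gamma> \<gamma> _ t] lD(2)) simp_all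
  next
    fix r u assume "r \<in> carrier K" "u \<in> carrier L"
    then show "tensor_lift K M N P (\<gamma> (r \<odot>\<^bsub>L\<^esub> u)) t = r \<odot>\<^bsub>P\<^esub> tensor_lift K M N P (\<gamma> u) t"
      by (intro tensor_lift_smult[OF assms(1-3) \<gamma> \<gamma> _ _ t] lD(3)) simp_all
  qed
qed

text \<open>The inner Sweedler sum is bilinear in the two outer variables, which is what makes the outer sum
  an honest lift; the linear map then passes through one sum at a time.\<close>

lemma linear_map_double_sweedler:
  assumes M: "module K M" and N: "module K N" and P: "module K P" and Q: "module K Q"
    and f: "f \<in> linear_maps K P Q"
    and inner: "\<And>x y. x \<in> carrier M \<Longrightarrow> y \<in> carrier M \<Longrightarrow> \<gamma> x y \<in> bilinear_maps K N N P"
    and outer: "\<And>u v. u \<in> carrier N \<Longrightarrow> v \<in> carrier N \<Longrightarrow>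
      (\<lambda>x y. \<gamma> x y u v) \<in> bilinear_maps K M M P"
    and s: "s \<in> carrier (tensor_product K M M)" and t: "t \<in> carrier (tensor_product K N N)"
  shows "f (tensor_lift K M M P (\<lambda>x y. tensor_lift K N N P (\<gamma> x y) t) s) =
    tensor_lift K M M Q (\<lambda>x y. tensor_lift K N N Q (\<lambda>u v. f (\<gamma> x y u v)) t) s"
proof -
  have "(\<lambda>x y. tensor_lift K N N P (\<gamma> x y) t) \<in> bilinear_maps K M M P"
    by (intro bilinear_mapsI tensor_lift_param_linear[OF N N P _ _ M t] inner
        bilinear_mapsD(1)[OF outer] bilinear_mapsD(2)[OF outer])
  then have "f (tensor_lift K M M P (\<lambda>x y. tensor_lift K N N P (\<gamma> x y) t) s) =
      tensor_lift K M M Q (\<lambda>x y. f (tensor_lift K N N P (\<gamma> x y) t)) s"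
    by (rule linear_map_tensor_lift[OF M M P Q f _ s])
  also have "\<dots> = tensor_lift K M M Q
      (\<lambda>x y. tensor_lift K N N Q (\<lambda>u v. f (\<gamma> x y u v)) t) s"
    by (intro fun_cong[OF tensor_lift_cong] linear_map_tensor_lift[OF N N P Q f inner t])
  finally show ?thesis .
qed

lemma tensor_map_linear:
  assumes "module K M" "module K N" "module K M'" "module K N'"
    and "f \<in> linear_maps K M M'" "g \<in> linear_maps K N N'"
  shows "tensor_map K M N M' N' f g \<in> linear_maps K (tensor_product K M N) (tensor_product K M' N')"
  unfolding tensor_map_def
  by (intro tensor_lift_linear tensor_product_module bilinear_maps_comp[OF pure_tensor_bilinear]
      assms)

lemma tensor_map_pure:
  assumes "module K M" "module K N" "module K M'" "module K N'"
    and "f \<in> linear_maps K M M'" "g \<in> linear_maps K N N'"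
    and "x \<in> carrier M" "y \<in> carrier N"
  shows "tensor_map K M N M' N' f g (pure_tensor K M N x y) = pure_tensor K M' N' (f x) (g y)"
  unfolding tensor_map_def
  by (intro tensor_lift_pure[of K M N "tensor_product K M' N'"
        "\<lambda>x y. pure_tensor K M' N' (f x) (g y)"]
      tensor_product_module bilinear_maps_comp[OF pure_tensor_bilinear] assms)

lemma tensor_map_comp:
  assumes "module K M" "module K N" "module K M'" "module K N'" "module K M''" "module K N''"
    and f: "f \<in> linear_maps K M M'" and g: "g \<in> linear_maps K N N'"
    and f': "f' \<in> linear_maps K M' M''" and g': "g' \<in> linear_maps K N' N''"
    and t: "t \<in> carrier (tensor_product K M N)"
  shows "tensor_map K M N M'' N'' (f' \<circ> f) (g' \<circ> g) t =
    tensor_map K M' N' M'' N'' f' g' (tensor_map K M N M' N' f g t)"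
proof -
  have f'f: "f' \<circ> f \<in> linear_maps K M M''" and g'g: "g' \<circ> g \<in> linear_maps K N N''"
    using linear_maps_comp[OF f' f] linear_maps_comp[OF g' g] by (simp_all add: comp_def)
  show ?thesis
    by (rule tensor_linear_eqI[OF assms(1,2) tensor_product_module[OF assms(5,6)]
          tensor_map_linear linear_maps_comp[OF tensor_map_linear tensor_map_linear] _ t])
       (simp_all add: assms(1-6) f g f' g' f'f g'g tensor_map_pure linear_mapsD(1)[OF f]
          linear_mapsD(1)[OF g])
qed

text \<open>This keeps a reassociated tensor inside the carrier, where maps such as \<open>\<alpha> \<otimes> \<mu>\<close> can be factored
  by \<open>tensor_map_comp\<close>. The associator is a lift whose values are themselves lifts, with the outer
  right-hand factor as a parameter of the inner one.\<close>

lemma tensor_assoc_linear: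
  assumes L: "module K L" and M: "module K M" and N: "module K N"
  shows "tensor_assoc K L M N \<in>
    linear_maps K (tensor_product K (tensor_product K L M) N)
      (tensor_product K L (tensor_product K M N))"
proof -
  let ?LM = "tensor_product K L M" and ?MN = "tensor_product K M N"
  let ?P = "tensor_product K L ?MN"
  let ?\<gamma> = "\<lambda>z x y. pure_tensor K L ?MN x (pure_tensor K M N y z)"
  have LM: "module K ?LM" and MN: "module K ?MN" and P: "module K ?P"
    by (intro tensor_product_module assms)+
  note outer = pure_tensor_bilinear[OF L MN] and inner = pure_tensor_bilinear[OF M N]
  have \<gamma>: "?\<gamma> z \<in> bilinear_maps K L M ?P" if "z \<in> carrier N" for z
    by (rule bilinear_maps_comp[OF outer linear_maps_id[of K L, unfolded id_def]
          bilinear_mapsD(2)[OF inner that], simplified])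
  have lin: "(\<lambda>z. ?\<gamma> z x y) \<in> linear_maps K N ?P" if "x \<in> carrier L" "y \<in> carrier M" for x y
    by (rule linear_maps_comp[OF bilinear_mapsD(1)[OF outer that(1)]
          bilinear_mapsD(1)[OF inner that(2)]])
  have "(\<lambda>t z. tensor_lift K L M ?P (?\<gamma> z) t) \<in> bilinear_maps K ?LM N ?P"
    by (intro bilinear_mapsI tensor_lift_param_linear[OF L M P \<gamma> lin N]
        tensor_lift_linear[OF L M P \<gamma>])
  then show ?thesis
    unfolding tensor_assoc_def by (rule tensor_lift_linear[OF LM N P])
qed

section \<open>Twisting a cobraided bialgebra\<close>

theorem theorem3p1:
  fixes K :: "('k, 'r) ring_scheme" and A :: "('k, 'a, 'm) module_scheme"
    and \<mu> :: "('a \<times> 'a \<Rightarrow> 'k) set \<Rightarrow> 'a" and \<Delta> :: "'a \<Rightarrow> ('a \<times> 'a \<Rightarrow> 'k) set"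
    and R :: "('a \<times> 'a \<Rightarrow> 'k) set \<Rightarrow> 'k" and \<alpha> :: "'a \<Rightarrow> 'a"
  assumes "char_zero_cring K"
    and "cobraided_bialgebra K A \<mu> \<Delta> R"
    and "\<alpha> \<in> bialgebra_morphisms K A \<mu> \<Delta> A \<mu> \<Delta>"
  shows "cobraided_hom_bialgebra K A (\<alpha> \<circ> \<mu>) (\<Delta> \<circ> \<alpha>) \<alpha> R"
proof -
  interpret B: cobraided_hom_bialgebra K A \<mu> \<Delta> id R by fact
  let ?AA = "tensor_product K A A"
  let ?p = "pure_tensor K A A"
  let ?\<alpha>\<alpha> = "tensor_map K A A A A \<alpha> \<alpha>"
  have A: "module K A" by (rule B.module_axioms)
  have AA: "module K ?AA" by (rule tensor_product_module[OF A A])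
  have \<alpha>: "\<alpha> \<in> linear_maps K A A"
    and \<alpha>\<mu>: "\<And>t. t \<in> carrier ?AA \<Longrightarrow> \<alpha> (\<mu> t) = \<mu> (?\<alpha>\<alpha> t)"
    and \<alpha>\<Delta>: "\<And>x. x \<in> carrier A \<Longrightarrow> ?\<alpha>\<alpha> (\<Delta> x) = \<Delta> (\<alpha> x)"
    using assms(3) by (auto simp: bialgebra_morphisms_def)
  have \<alpha>\<alpha>: "?\<alpha>\<alpha> \<in> linear_maps K ?AA ?AA" by (rule tensor_map_linear[OF A A A A \<alpha> \<alpha>])
  note \<alpha>C = linear_mapsD(1)[OF \<alpha>] and \<mu>C = linear_mapsD(1)[OF B.mult_linear]
    and \<Delta>C = linear_mapsD(1)[OF B.comult_linear] and pC = pure_tensor_closed[OF A A]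
  note pL = bilinear_mapsD(1)[OF pure_tensor_bilinear[OF A A]]
    and pR = bilinear_mapsD(2)[OF pure_tensor_bilinear[OF A A]]
  have \<alpha>\<mu>_pure: "\<alpha> (\<mu> (?p x y)) = \<mu> (?p (\<alpha> x) (\<alpha> y))" if "x \<in> carrier A" "y \<in> carrier A" for x y
    using that by (simp add: \<alpha>\<mu> pC tensor_map_pure[OF A A A A \<alpha> \<alpha>])
  note \<mu>L = linear_maps_comp[OF B.mult_linear pL] and \<mu>R = linear_maps_comp[OF B.mult_linear pR]
  note RL = linear_maps_comp[OF B.form_linear pL] and RR = linear_maps_comp[OF B.form_linear pR]
  show ?thesis
  proof
    show "\<alpha> \<circ> \<mu> \<in> linear_maps K ?AA A" "\<Delta> \<circ> \<alpha> \<in> linear_maps K A ?AA"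
      using linear_maps_comp[OF \<alpha> B.mult_linear] linear_maps_comp[OF B.comult_linear \<alpha>]
      by (simp_all add: comp_def)
    show "\<alpha> \<in> linear_maps K A A" by (rule \<alpha>)
    show "R \<in> linear_maps K ?AA (ring_as_module K)" by (rule B.form_linear)
  next
    fix t assume "t \<in> carrier ?AA"
    then show "\<alpha> ((\<alpha> \<circ> \<mu>) t) = (\<alpha> \<circ> \<mu>) (?\<alpha>\<alpha> t)" by (simp add: \<alpha>\<mu>)
  next
    fix t assume t: "t \<in> carrier (tensor_product K ?AA A)"
    let ?u = "tensor_assoc K A A A t"
    have u: "?u \<in> carrier (tensor_product K A ?AA)"
      by (rule linear_mapsD(1)[OF tensor_assoc_linear[OF A A A] t])
    \<comment> \<open>The common factor \<open>\<alpha> \<otimes> \<alpha>\<close> on the left becomes one more \<open>\<alpha>\<close> outside \<open>\<mu>\<close>, on both sides.\<close>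
    have left: "tensor_map K A ?AA A A \<alpha> (\<alpha> \<circ> \<mu>) ?u = ?\<alpha>\<alpha> (tensor_map K A ?AA A A id \<mu> ?u)"
      using tensor_map_comp[OF A AA A A A A linear_maps_id B.mult_linear \<alpha> \<alpha> u] by simp
    have right: "tensor_map K ?AA A A A (\<alpha> \<circ> \<mu>) \<alpha> t = ?\<alpha>\<alpha> (tensor_map K ?AA A A A \<mu> id t)"
      using tensor_map_comp[OF AA A A A A A B.mult_linear linear_maps_id \<alpha> \<alpha> t] by simp
    have "tensor_map K A ?AA A A id \<mu> ?u \<in> carrier ?AA"
      by (rule linear_mapsD(1)[OF tensor_map_linear[OF A AA A A linear_maps_id B.mult_linear] u])
    moreover have "tensor_map K ?AA A A A \<mu> id t \<in> carrier ?AA"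
      by (rule linear_mapsD(1)[OF tensor_map_linear[OF AA A A A B.mult_linear linear_maps_id] t])
    ultimately show "(\<alpha> \<circ> \<mu>) (tensor_map K A ?AA A A \<alpha> (\<alpha> \<circ> \<mu>) ?u) =
        (\<alpha> \<circ> \<mu>) (tensor_map K ?AA A A A (\<alpha> \<circ> \<mu>) \<alpha> t)"
      using B.hom_assoc[OF t] by (simp add: left right \<alpha>\<mu>[symmetric])
  next
    fix x assume "x \<in> carrier A"
    then show "?\<alpha>\<alpha> ((\<Delta> \<circ> \<alpha>) x) = (\<Delta> \<circ> \<alpha>) (\<alpha> x)" by (simp add: \<alpha>\<Delta> \<alpha>C)
  next
    fix x assume x: "x \<in> carrier A"
    let ?d = "\<Delta> (\<alpha> x)"
    have d: "?d \<in> carrier ?AA" and \<alpha>d: "?\<alpha>\<alpha> ?d = \<Delta> (\<alpha> (\<alpha> x))"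
      using x by (simp_all add: \<alpha>C \<Delta>C \<alpha>\<Delta>)
    \<comment> \<open>Here \<open>\<alpha> \<otimes> \<alpha>\<close> is split off on the right, where \<open>\<Delta> \<circ> \<alpha>\<close> absorbs it.\<close>
    have "tensor_map K A A A ?AA \<alpha> (\<Delta> \<circ> \<alpha>) ?d = tensor_map K A A A ?AA id \<Delta> (?\<alpha>\<alpha> ?d)"
      using tensor_map_comp[OF A A A A A AA \<alpha> \<alpha> linear_maps_id B.comult_linear d] by simp
    moreover have "tensor_map K A A ?AA A (\<Delta> \<circ> \<alpha>) \<alpha> ?d = tensor_map K A A ?AA A \<Delta> id (?\<alpha>\<alpha> ?d)"
      using tensor_map_comp[OF A A A A AA A \<alpha> \<alpha> B.comult_linear linear_maps_id d] by simp
    ultimately show "tensor_map K A A A ?AA \<alpha> (\<Delta> \<circ> \<alpha>) ((\<Delta> \<circ> \<alpha>) x) =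
        tensor_assoc K A A A (tensor_map K A A ?AA A (\<Delta> \<circ> \<alpha>) \<alpha> ((\<Delta> \<circ> \<alpha>) x))"
      using B.hom_coassoc[of "\<alpha> (\<alpha> x)"] x by (simp add: \<alpha>d \<alpha>C)
  next
    fix a b assume ab: "a \<in> carrier A" "b \<in> carrier A"
    let ?\<gamma> = "\<lambda>a1 a2 b1 b2. ?p (\<mu> (?p a1 b1)) (\<mu> (?p a2 b2))"
    have inner: "?\<gamma> x y \<in> bilinear_maps K A A ?AA" if "x \<in> carrier A" "y \<in> carrier A" for x y
      by (rule bilinear_maps_comp[OF pure_tensor_bilinear[OF A A] \<mu>L[OF that(1)] \<mu>L[OF that(2)]])
    have outer: "(\<lambda>x y. ?\<gamma> x y u v) \<in> bilinear_maps K A A ?AA"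
      if "u \<in> carrier A" "v \<in> carrier A" for u v
      by (rule bilinear_maps_comp[OF pure_tensor_bilinear[OF A A] \<mu>R[OF that(1)] \<mu>R[OF that(2)]])
    have "(\<Delta> \<circ> \<alpha>) ((\<alpha> \<circ> \<mu>) (?p a b)) = ?\<alpha>\<alpha> (\<Delta> (\<mu> (?p (\<alpha> a) (\<alpha> b))))"
      using ab by (simp add: \<alpha>\<mu>_pure \<alpha>\<Delta> \<mu>C pC \<alpha>C)
    also have "\<dots> = ?\<alpha>\<alpha> (tensor_lift K A A ?AA
        (\<lambda>a1 a2. tensor_lift K A A ?AA (?\<gamma> a1 a2) (\<Delta> (\<alpha> b))) (\<Delta> (\<alpha> a)))"
      using ab by (simp add: B.comult_mult \<alpha>C)
    also have "\<dots> = tensor_lift K A A ?AA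
        (\<lambda>a1 a2. tensor_lift K A A ?AA (\<lambda>b1 b2. ?\<alpha>\<alpha> (?\<gamma> a1 a2 b1 b2)) (\<Delta> (\<alpha> b))) (\<Delta> (\<alpha> a))"
      by (rule linear_map_double_sweedler[OF A A AA AA \<alpha>\<alpha> inner outer])
         (use ab in \<open>simp_all add: \<Delta>C \<alpha>C\<close>)
    also have "\<dots> = tensor_lift K A A ?AA
        (\<lambda>a1 a2. tensor_lift K A A ?AA
          (\<lambda>b1 b2. ?p ((\<alpha> \<circ> \<mu>) (?p a1 b1)) ((\<alpha> \<circ> \<mu>) (?p a2 b2))) ((\<Delta> \<circ> \<alpha>) b)) ((\<Delta> \<circ> \<alpha>) a)"
      unfolding comp_apply
      by (intro fun_cong[OF tensor_lift_cong] tensor_map_pure[OF A A A A \<alpha> \<alpha>] \<mu>C pC)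
    finally show "(\<Delta> \<circ> \<alpha>) ((\<alpha> \<circ> \<mu>) (?p a b)) = tensor_lift K A A ?AA
        (\<lambda>a1 a2. tensor_lift K A A ?AA
          (\<lambda>b1 b2. ?p ((\<alpha> \<circ> \<mu>) (?p a1 b1)) ((\<alpha> \<circ> \<mu>) (?p a2 b2))) ((\<Delta> \<circ> \<alpha>) b)) ((\<Delta> \<circ> \<alpha>) a)" .
  next
    fix x y z assume xyz: "x \<in> carrier A" "y \<in> carrier A" "z \<in> carrier A"
    show "R (?p ((\<alpha> \<circ> \<mu>) (?p x y)) (\<alpha> z)) = tensor_lift K A A (ring_as_module K)
        (\<lambda>z1 z2. R (?p (\<alpha> x) z1) \<otimes>\<^bsub>K\<^esub> R (?p (\<alpha> y) z2)) ((\<Delta> \<circ> \<alpha>) z)"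
      using B.form_mult_left[of "\<alpha> x" "\<alpha> y" "\<alpha> z"] xyz by (simp add: \<alpha>\<mu>_pure \<alpha>C)
    show "R (?p (\<alpha> x) ((\<alpha> \<circ> \<mu>) (?p y z))) = tensor_lift K A A (ring_as_module K)
        (\<lambda>x1 x2. R (?p x1 (\<alpha> z)) \<otimes>\<^bsub>K\<^esub> R (?p x2 (\<alpha> y))) ((\<Delta> \<circ> \<alpha>) x)"
      using B.form_mult_right[of "\<alpha> x" "\<alpha> y" "\<alpha> z"] xyz by (simp add: \<alpha>\<mu>_pure \<alpha>C)
  next
    fix x y assume xy: "x \<in> carrier A" "y \<in> carrier A"
    note sm = smult_bilinear[OF A]
    have RC: "R (?p u v) \<in> carrier K" if "u \<in> carrier A" "v \<in> carrier A" for u v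
      using linear_mapsD(1)[OF B.form_linear pC[OF that]] by (simp add: ring_as_module_def)
    \<comment> \<open>Both sides of the commutation relation are double sums over \<open>\<Delta> (\<alpha> x)\<close> and \<open>\<Delta> (\<alpha> y)\<close>, and in both
      the outer \<open>\<alpha>\<close> of \<open>\<alpha> \<circ> \<mu>\<close> has to be pulled out past the scalars \<open>R (_ \<otimes> _)\<close>.\<close>
    have pull: "\<alpha> (tensor_lift K A A A (\<lambda>x1 x2. tensor_lift K A A A (\<gamma> x1 x2) (\<Delta> (\<alpha> y))) (\<Delta> (\<alpha> x))) =
        tensor_lift K A A A (\<lambda>x1 x2. tensor_lift K A A A (\<gamma>' x1 x2) (\<Delta> (\<alpha> y))) (\<Delta> (\<alpha> x))"
      if inner: "\<And>x1 x2. x1 \<in> carrier A \<Longrightarrow> x2 \<in> carrier A \<Longrightarrow> \<gamma> x1 x2 \<in> bilinear_maps K A A A"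
        and outer: "\<And>y1 y2. y1 \<in> carrier A \<Longrightarrow> y2 \<in> carrier A \<Longrightarrow>
          (\<lambda>x1 x2. \<gamma> x1 x2 y1 y2) \<in> bilinear_maps K A A A"
        and eq: "\<And>x1 x2 y1 y2. x1 \<in> carrier A \<Longrightarrow> x2 \<in> carrier A \<Longrightarrow> y1 \<in> carrier A \<Longrightarrow>
          y2 \<in> carrier A \<Longrightarrow> \<alpha> (\<gamma> x1 x2 y1 y2) = \<gamma>' x1 x2 y1 y2"
      for \<gamma> \<gamma>'
    proof -
      have "\<Delta> (\<alpha> x) \<in> carrier ?AA" "\<Delta> (\<alpha> y) \<in> carrier ?AA" using xy by (simp_all add: \<Delta>C \<alpha>C)
      note linear_map_double_sweedler[where \<gamma> = \<gamma>, OF A A A A \<alpha> inner outer this]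
      also have "tensor_lift K A A A
          (\<lambda>x1 x2. tensor_lift K A A A (\<lambda>y1 y2. \<alpha> (\<gamma> x1 x2 y1 y2)) (\<Delta> (\<alpha> y))) (\<Delta> (\<alpha> x)) =
          tensor_lift K A A A (\<lambda>x1 x2. tensor_lift K A A A (\<gamma>' x1 x2) (\<Delta> (\<alpha> y))) (\<Delta> (\<alpha> x))"
        by (intro fun_cong[OF tensor_lift_cong] eq)
      finally show ?thesis .
    qed
    have 1: "\<alpha> (tensor_lift K A A A (\<lambda>x1 x2. tensor_lift K A A A
          (\<lambda>y1 y2. R (?p x2 y2) \<odot>\<^bsub>A\<^esub> \<mu> (?p y1 x1)) (\<Delta> (\<alpha> y))) (\<Delta> (\<alpha> x))) =
        tensor_lift K A A A (\<lambda>x1 x2. tensor_lift K A A A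
          (\<lambda>y1 y2. R (?p x2 y2) \<odot>\<^bsub>A\<^esub> \<alpha> (\<mu> (?p y1 x1))) (\<Delta> (\<alpha> y))) (\<Delta> (\<alpha> x))"
    proof (rule pull)
      fix u v assume uv: "u \<in> carrier A" "v \<in> carrier A"
      show "(\<lambda>y1 y2. R (?p v y2) \<odot>\<^bsub>A\<^esub> \<mu> (?p y1 u)) \<in> bilinear_maps K A A A"
        by (rule bilinear_maps_flip[OF bilinear_maps_comp[OF sm RL[OF uv(2)] \<mu>R[OF uv(1)]]])
      show "(\<lambda>x1 x2. R (?p x2 v) \<odot>\<^bsub>A\<^esub> \<mu> (?p u x1)) \<in> bilinear_maps K A A A"
        by (rule bilinear_maps_flip[OF bilinear_maps_comp[OF sm RR[OF uv(2)] \<mu>L[OF uv(1)]]])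
    qed (simp add: linear_mapsD(3)[OF \<alpha>] RC \<mu>C pC)
    have 2: "\<alpha> (tensor_lift K A A A (\<lambda>x1 x2. tensor_lift K A A A
          (\<lambda>y1 y2. R (?p x1 y1) \<odot>\<^bsub>A\<^esub> \<mu> (?p x2 y2)) (\<Delta> (\<alpha> y))) (\<Delta> (\<alpha> x))) =
        tensor_lift K A A A (\<lambda>x1 x2. tensor_lift K A A A
          (\<lambda>y1 y2. R (?p x1 y1) \<odot>\<^bsub>A\<^esub> \<alpha> (\<mu> (?p x2 y2))) (\<Delta> (\<alpha> y))) (\<Delta> (\<alpha> x))"
    proof (rule pull)
      fix u v assume uv: "u \<in> carrier A" "v \<in> carrier A"
      show "(\<lambda>y1 y2. R (?p u y1) \<odot>\<^bsub>A\<^esub> \<mu> (?p v y2)) \<in> bilinear_maps K A A A"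
        by (rule bilinear_maps_comp[OF sm RL[OF uv(1)] \<mu>L[OF uv(2)]])
      show "(\<lambda>x1 x2. R (?p x1 u) \<odot>\<^bsub>A\<^esub> \<mu> (?p x2 v)) \<in> bilinear_maps K A A A"
        by (rule bilinear_maps_comp[OF sm RR[OF uv(1)] \<mu>R[OF uv(2)]])
    qed (simp add: linear_mapsD(3)[OF \<alpha>] RC \<mu>C pC)
    show "tensor_lift K A A A (\<lambda>x1 x2. tensor_lift K A A A
          (\<lambda>y1 y2. R (?p x2 y2) \<odot>\<^bsub>A\<^esub> (\<alpha> \<circ> \<mu>) (?p y1 x1)) ((\<Delta> \<circ> \<alpha>) y)) ((\<Delta> \<circ> \<alpha>) x) =
        tensor_lift K A A A (\<lambda>x1 x2. tensor_lift K A A A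
          (\<lambda>y1 y2. R (?p x1 y1) \<odot>\<^bsub>A\<^esub> (\<alpha> \<circ> \<mu>) (?p x2 y2)) ((\<Delta> \<circ> \<alpha>) y)) ((\<Delta> \<circ> \<alpha>) x)"
      unfolding comp_apply 1[symmetric] 2[symmetric]
      using B.form_commute[of "\<alpha> x" "\<alpha> y"] xy by (simp add: \<alpha>C)
  qed
qed

end
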